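(* Let $f: \mathcal{S}^{3\times 3} \to \mathbb{R}$. Then $f$ is symmetric polyaffine if and only if it is affine, i.e. there are $B\in \mathcal{S}^{3\times 3}$ and $b\in \mathbb{R}$ such that $$f(\varepsilon) = B:\varepsilon +b \quad\text{for all } \varepsilon\in \mathcal{S}^{3\times 3}.$$
   Context: $\mathcal{S}^{3\times 3}$ is the space of symmetric matrices in $\mathbb{R}^{3\times 3}$, $F^s=\frac12(F+F^T)$, and $A:B=\sum_{i,j}A_{ij}B_{ij}$. The cofactor matrix is $(\operatorname{cof}F)_{ij}=(-1)^{i+j}\det\widehat F_{ij}$, where $\widehat F_{ij}$ is $F$ with row $i$ and column $j$ deleted. A function $\tilde f:\mathbb{R}^{3\times 3}\to\mathbb{R}$ is polyconvex if there is a convex function $G:\mathbb{R}^{3\times 3}\times\mathbb{R}^{3\times 3}\times\mathbb{R}\to\mathbb{R}$ with $\tilde f(F)=G(F,\operatorname{cof}F,\det F)$ for all $F$. A function $f:\mathcal{S}^{3\times 3}\to\mathbb{R}$ is symmetric polyconvex if $\tilde f:\mathbb{R}^{3\times 3}\to\mathbb{R}$, $\tilde f(F)=f(F^s)$, is polyconvex; it is symmetric polyaffine if both $f$ and $-f$ are symmetric polyconvex. *)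

theory Defs
  imports "HOL-Analysis.Analysis"
begin

type_synonym mat3 = "real^3^3"

definition sym_mats :: "mat3 set" where
  "sym_mats = {A. transpose A = A}"

definition sym_part :: "mat3 \<Rightarrow> mat3" where
  "sym_part F = (1/2) *\<^sub>R (F + transpose F)"

text \<open>In the type \<^typ>\<open>3\<close> the numeral 3 is the element 0. The following two functions fix the
  reading of the indices as 1, 2, 3, in this order.\<close>

definition index3 :: "3 \<Rightarrow> nat" where
  "index3 i = (if i = 1 then 1 else if i = 2 then 2 else 3)"

text \<open>The increasing enumeration of the indices other than \<open>i\<close>.\<close>

definition skip :: "3 \<Rightarrow> 2 \<Rightarrow> 3" where
  "skip i k = (if k = 1 then (if i = 1 then 2 else 1) else (if i = 3 then 2 else 3))"

definition minor_mat :: "mat3 \<Rightarrow> 3 \<Rightarrow> 3 \<Rightarrow> real^2^2" where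
  "minor_mat F i j = (\<chi> k l. F $ skip i k $ skip j l)"

definition cof :: "mat3 \<Rightarrow> mat3" where
  "cof F = (\<chi> i j. (- 1) ^ (index3 i + index3 j) * det (minor_mat F i j))"

lemma mult_transpose_cof: "F ** transpose (cof F) = det F *\<^sub>R mat 1"
  by (simp add: vec_eq_iff forall_3 matrix_matrix_mult_def transpose_def cof_def minor_mat_def
      mat_def sum_3 det_2 det_3 index3_def skip_def) (simp add: algebra_simps)

definition polyconvex :: "(mat3 \<Rightarrow> real) \<Rightarrow> bool" where
  "polyconvex g \<longleftrightarrow>
     (\<exists>G :: mat3 \<times> mat3 \<times> real \<Rightarrow> real.
        convex_on UNIV G \<and> (\<forall>F. g F = G (F, cof F, det F)))"

text \<open>A function on the symmetric matrices is represented by a total function on all matrices.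
  Its values outside \<^const>\<open>sym_mats\<close> play no role, since \<^const>\<open>sym_part\<close> maps into
  \<^const>\<open>sym_mats\<close>.\<close>

definition symmetric_polyconvex :: "(mat3 \<Rightarrow> real) \<Rightarrow> bool" where
  "symmetric_polyconvex f \<longleftrightarrow> polyconvex (\<lambda>F. f (sym_part F))"

definition symmetric_polyaffine :: "(mat3 \<Rightarrow> real) \<Rightarrow> bool" where
  "symmetric_polyaffine f \<longleftrightarrow>
     symmetric_polyconvex f \<and> symmetric_polyconvex (\<lambda>\<epsilon>. - f \<epsilon>)"

lemma sym_part_in_sym_mats: "sym_part F \<in> sym_mats"
  by (simp add: sym_part_def sym_mats_def transpose_def vec_eq_iff)

lemma sym_part_of_sym: "A \<in> sym_mats \<Longrightarrow> sym_part A = A"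
  by (simp add: sym_part_def sym_mats_def vec_eq_iff)

text \<open>The contraction \<open>A : B\<close> is the library's inner product on \<^typ>\<open>mat3\<close>.\<close>

lemma inner_mat3: "(A :: mat3) \<bullet> B = (\<Sum>i\<in>UNIV. \<Sum>j\<in>UNIV. A $ i $ j * B $ i $ j)"
  by (simp add: inner_vec_def)

end

theory Submission
  imports Defs
begin

text \<open>
  Let \<open>f\<close> be symmetric polyaffine and \<open>g F = f (sym_part F)\<close>. Both \<open>g\<close> and \<open>- g\<close> are convex
  functions of the minors of \<open>F\<close>. Every minor is affine along a line with a rank-one direction \<open>a \<otimes> b\<close>, so \<open>g\<close> is both
  convex and concave, that is affine, along such a line. What makes the symmetric case rigid is
  that \<open>g\<close> sees only the symmetric part of the direction: since \<open>a \<otimes> a - b \<otimes> b\<close> is the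
  symmetric part of \<open>(a - b) \<otimes> (a + b)\<close>, the function \<open>g\<close> is affine along \<open>a \<otimes> a\<close>, along \<open>b \<otimes> b\<close> and
  also along their difference. Being affine along the first two, \<open>g\<close> can only have a mixed term
  \<open>d s t\<close> on the plane that they span, and the third direction forces \<open>d = 0\<close>
  (\<open>affine_on_plane_no_mixed_term\<close>). Hence the slope of \<open>g\<close> in direction \<open>a \<otimes> a\<close> does
  not change under translation by a multiple of any \<open>b \<otimes> b\<close>. These matrices span the symmetric
  matrices, so each slope is constant (\<open>slope_constant\<close>), and summing the six slopes that belong
  to a basis of matrices \<open>a \<otimes> a\<close> gives an affine formula for \<open>f\<close>.
  Conversely, an affine \<open>f\<close> makes \<open>g\<close> affine in \<open>F\<close> itself.
\<close>

section \<open>Affine functions of one and two real variables\<close>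

lemma convex_concave_real_affine:
  fixes \<phi> :: "real \<Rightarrow> real"
  assumes "convex_on UNIV \<phi>" and "convex_on UNIV (\<lambda>s. - \<phi> s)"
  shows "\<phi> t = \<phi> 0 + t * (\<phi> 1 - \<phi> 0)"
proof -
  have seg: "\<phi> ((1 - u) * x + u * y) = (1 - u) * \<phi> x + u * \<phi> y" if "0 \<le> u" "u \<le> 1" for u x y
    using convex_onD[OF assms(1), of u x y] convex_onD[OF assms(2), of u x y] that by simp
  \<comment> \<open>The middle one of the points \<open>0\<close>, \<open>1\<close> and \<open>t\<close> is a convex combination of the other two.\<close>
  consider "t < 0" | "0 \<le> t" "t \<le> 1" | "1 < t" by linarith
  then show ?thesis
  proof cases
    case 1
    define u where "u = 1 / (1 - t)"
    have u: "0 \<le> u" "u \<le> 1" "u * (1 - t) = 1"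
      using 1 by (simp_all add: u_def)
    have "(1 - u) * 1 + u * t = 0" using u(3) by (simp add: algebra_simps)
    then have "\<phi> 0 = (1 - u) * \<phi> 1 + u * \<phi> t"
      using seg[of u 1 t] u by simp
    then have "(1 - t) * \<phi> 0 = (1 - t) * ((1 - u) * \<phi> 1 + u * \<phi> t)"
      by simp
    also have "\<dots> = ((1 - t) - u * (1 - t)) * \<phi> 1 + u * (1 - t) * \<phi> t"
      by (simp add: algebra_simps)
    finally show ?thesis unfolding u(3) by (simp add: algebra_simps)
  next
    case 2
    then show ?thesis using seg[of t 0 1] by (simp add: algebra_simps)
  next
    case 3
    then have "\<phi> 1 = (1 - 1 / t) * \<phi> 0 + 1 / t * \<phi> t"
      using seg[of "1 / t" 0 t] by (simp add: field_simps)
    with 3 show ?thesis by (simp add: field_simps)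
  qed
qed

text \<open>Affinity in \<open>s\<close> and in \<open>t\<close> leaves the form \<open>a + b s + c t + d s t\<close>; along the line
  \<open>(r, - r)\<close> the last term is \<open>- d r\<^sup>2\<close>, which is affine only for \<open>d = 0\<close>.\<close>

lemma affine_on_plane_no_mixed_term:
  fixes h :: "real \<Rightarrow> real \<Rightarrow> real"
  assumes s: "\<And>s t. h s t = h 0 t + s * (h 1 t - h 0 t)"
    and t: "\<And>s t. h s t = h s 0 + t * (h s 1 - h s 0)"
    and diag: "\<And>r. h r (- r) = h 0 0 + r * (h 1 (- 1) - h 0 0)"
  shows "h 1 t - h 0 t = h 1 0 - h 0 0"
proof -
  have "h (- 1) 1 + h 1 (- 1) = 2 * h 0 0"
    using diag[of "- 1"] by simp
  moreover have "h (- 1) 1 = 2 * h 0 1 - h 1 1"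
    using s[of "- 1" 1] by simp
  moreover have "h 1 (- 1) = 2 * h 1 0 - h 1 1"
    using t[of 1 "- 1"] by simp
  ultimately have "h 1 1 - h 1 0 = h 0 1 - h 0 0" by linarith
  then show ?thesis using t[of 1 t] t[of 0 t] by simp
qed

section \<open>Polyconvex functions along rank-one lines\<close>

definition outer :: "real^3 \<Rightarrow> real^3 \<Rightarrow> mat3" where
  "outer a b = (\<chi> i j. a $ i * b $ j)"

text \<open>All terms of degree at least two in \<open>t\<close> carry a minor of \<open>outer a b\<close> of order at
  least two as a factor, and these minors vanish.\<close>

lemma det_affine_rank_one:
  "det (F + t *\<^sub>R outer a b) = det F + t * (det (F + outer a b) - det F)"
  by (simp add: det_3 outer_def algebra_simps)

lemma cof_affine_rank_one:
  "cof (F + t *\<^sub>R outer a b) = cof F + t *\<^sub>R (cof (F + outer a b) - cof F)"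
  by (simp add: vec_eq_iff forall_3 cof_def minor_mat_def det_2 index3_def skip_def outer_def)
     (simp add: algebra_simps)

lemma polyconvex_convex_rank_one:
  assumes "polyconvex g"
  shows "convex_on UNIV (\<lambda>t. g (F + t *\<^sub>R outer a b))"
proof -
  obtain G :: "mat3 \<times> mat3 \<times> real \<Rightarrow> real"
    where G: "convex_on UNIV G" "\<And>F. g F = G (F, cof F, det F)"
    using assms unfolding polyconvex_def by blast
  define p where "p = (F, cof F, det F)"
  define q where "q = (outer a b, cof (F + outer a b) - cof F, det (F + outer a b) - det F)"
  have line: "g (F + t *\<^sub>R outer a b) = G (p + t *\<^sub>R q)" for t
    unfolding G(2) p_def q_def
    by (subst cof_affine_rank_one, subst det_affine_rank_one) simp
  show ?thesis unfolding line
  proof (rule convex_onI)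
    fix u x y :: real assume "0 < u" "u < 1"
    then have "G ((1 - u) *\<^sub>R (p + x *\<^sub>R q) + u *\<^sub>R (p + y *\<^sub>R q))
        \<le> (1 - u) * G (p + x *\<^sub>R q) + u * G (p + y *\<^sub>R q)"
      using convex_onD[OF G(1)] by simp
    moreover have "(1 - u) *\<^sub>R (p + x *\<^sub>R q) + u *\<^sub>R (p + y *\<^sub>R q)
        = p + ((1 - u) *\<^sub>R x + u *\<^sub>R y) *\<^sub>R q"
      by (simp add: algebra_simps)
    ultimately show "G (p + ((1 - u) *\<^sub>R x + u *\<^sub>R y) *\<^sub>R q)
        \<le> (1 - u) * G (p + x *\<^sub>R q) + u * G (p + y *\<^sub>R q)" by simp
  qed simp
qed

lemma polyaffine_affine_rank_one:
  assumes "polyconvex g" "polyconvex (\<lambda>F. - g F)"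
  shows "g (F + t *\<^sub>R outer a b) = g F + t * (g (F + outer a b) - g F)"
  using convex_concave_real_affine[OF polyconvex_convex_rank_one[OF assms(1), of F a b]
      polyconvex_convex_rank_one[OF assms(2), of F a b], of t] by simp

section \<open>Symmetric rank-one directions\<close>

lemma sym_part_add: "sym_part (F + G) = sym_part F + sym_part G"
  and sym_part_scaleR: "sym_part (t *\<^sub>R F) = t *\<^sub>R sym_part F"
  by (simp_all add: sym_part_def transpose_def vec_eq_iff algebra_simps)

lemma sym_part_sym_part: "sym_part (sym_part F) = sym_part F"
  by (simp add: sym_part_in_sym_mats sym_part_of_sym)

text \<open>The identity behind the rigidity: a difference of symmetric dyads is again, up to an
  antisymmetric matrix, of rank one.\<close>

lemma sym_part_outer_diff_sum:
  fixes a b :: "real^3"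
  shows "sym_part (outer (a - b) (a + b)) = sym_part (outer a a - outer b b)"
  by (simp add: sym_part_def outer_def transpose_def vec_eq_iff algebra_simps)

text \<open>The six dyads of \<open>e\<^sub>i\<close> and of \<open>e\<^sub>i + e\<^sub>j\<close> span the symmetric matrices: a dyad of
  \<open>e\<^sub>i + e\<^sub>j\<close> supplies the entry \<open>(i, j)\<close> and adds the same amount to the diagonal entries
  \<open>i\<close> and \<open>j\<close>, which the dyads of the \<open>e\<^sub>i\<close> take off again.\<close>

lemma symmetric_dyad_decomposition:
  assumes "\<epsilon> \<in> sym_mats"
  shows "\<epsilon> = (\<epsilon>$1$1 - \<epsilon>$1$2 - \<epsilon>$1$3) *\<^sub>R outer (axis 1 1) (axis 1 1)
           + (\<epsilon>$2$2 - \<epsilon>$1$2 - \<epsilon>$2$3) *\<^sub>R outer (axis 2 1) (axis 2 1)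
           + (\<epsilon>$3$3 - \<epsilon>$1$3 - \<epsilon>$2$3) *\<^sub>R outer (axis 3 1) (axis 3 1)
           + \<epsilon>$1$2 *\<^sub>R outer (axis 1 1 + axis 2 1) (axis 1 1 + axis 2 1)
           + \<epsilon>$1$3 *\<^sub>R outer (axis 1 1 + axis 3 1) (axis 1 1 + axis 3 1)
           + \<epsilon>$2$3 *\<^sub>R outer (axis 2 1 + axis 3 1) (axis 2 1 + axis 3 1)"
proof -
  have "\<epsilon>$2$1 = \<epsilon>$1$2" "\<epsilon>$3$1 = \<epsilon>$1$3" "\<epsilon>$3$2 = \<epsilon>$2$3"
    using assms by (simp_all add: sym_mats_def transpose_def vec_eq_iff)
  then show ?thesis
    by (simp add: vec_eq_iff forall_3 outer_def axis_def)
qed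

lemma dyad_invariant_constant:
  assumes dyad: "\<And>F t b. h (F + t *\<^sub>R outer b b) = h F"
    and sym: "\<And>F. h (sym_part F) = h F"
  shows "h F = h 0"
proof -
  have dyad0: "h (t *\<^sub>R outer b b) = h 0" for t b
    using dyad[of 0] by simp
  have "h (sym_part F) = h 0"
    by (subst symmetric_dyad_decomposition[OF sym_part_in_sym_mats]) (simp only: dyad dyad0)
  then show ?thesis by (simp add: sym)
qed

section \<open>Symmetric polyaffine functions are affine\<close>

text \<open>Rank-one affinity gives this with a slope that may depend on the base point \<open>F\<close>. On the
  plane through \<open>F\<close> spanned by two dyads the mixed term vanishes, so the slope is the
  same after a translation by a multiple of any dyad, and therefore at \<open>0\<close>.\<close>

lemma slope_constant:
  assumes g: "polyconvex g" "polyconvex (\<lambda>F. - g F)"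
    and sym: "\<And>F. g (sym_part F) = g F"
  shows "g (F + t *\<^sub>R outer a a) = g F + t * (g (outer a a) - g 0)"
proof -
  have same: "g F = g F'" if "sym_part F = sym_part F'" for F F'
    using sym[of F] sym[of F'] that by simp
  have "g (F + outer a a) - g F = g (0 + outer a a) - g 0"
  proof (rule dyad_invariant_constant[where h = "\<lambda>F. g (F + outer a a) - g F"])
    fix F and t :: real and b
    define h where "h s t = g (F + s *\<^sub>R outer a a + t *\<^sub>R outer b b)" for s t
    have "h 1 t - h 0 t = h 1 0 - h 0 0"
    proof (rule affine_on_plane_no_mixed_term)
      show "h s t = h 0 t + s * (h 1 t - h 0 t)" for s t
        using polyaffine_affine_rank_one[OF g, of "F + t *\<^sub>R outer b b" s a a]
        by (simp add: h_def add_ac)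
      show "h s t = h s 0 + t * (h s 1 - h s 0)" for s t
        using polyaffine_affine_rank_one[OF g, of "F + s *\<^sub>R outer a a" t b b]
        by (simp add: h_def)
      have "h r (- r) = g (F + r *\<^sub>R outer (a - b) (a + b))" for r
      proof -
        have "F + r *\<^sub>R outer a a + (- r) *\<^sub>R outer b b = F + r *\<^sub>R (outer a a - outer b b)"
          by (simp add: algebra_simps)
        then show ?thesis unfolding h_def
          by (intro same) (simp only: sym_part_add sym_part_scaleR sym_part_outer_diff_sum)
      qed
      note diag = this
      show "h r (- r) = h 0 0 + r * (h 1 (- 1) - h 0 0)" for r
        using polyaffine_affine_rank_one[OF g, of F r "a - b" "a + b"] diag[of r] diag[of 1]
        by (simp add: h_def)
    qed
    then show "g (F + t *\<^sub>R outer b b + outer a a) - g (F + t *\<^sub>R outer b b)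
        = g (F + outer a a) - g F"
      by (simp add: h_def add_ac)
  next
    fix F
    show "g (sym_part F + outer a a) - g (sym_part F) = g (F + outer a a) - g F"
      using same[of "sym_part F + outer a a" "F + outer a a"]
      by (simp add: sym sym_part_add sym_part_sym_part)
  qed
  then show ?thesis using polyaffine_affine_rank_one[OF g, of F t a a] by simp
qed

lemma symmetric_polyaffine_imp_affine:
  assumes "symmetric_polyaffine f"
  shows "\<exists>B\<in>sym_mats. \<exists>b. \<forall>\<epsilon>\<in>sym_mats. f \<epsilon> = B \<bullet> \<epsilon> + b"
proof -
  define g where "g F = f (sym_part F)" for F
  have g: "polyconvex g" "polyconvex (\<lambda>F. - g F)"
    using assms by (simp_all add: g_def[abs_def] symmetric_polyaffine_def symmetric_polyconvex_def)
  define L where "L a = g (outer a a) - g 0" for a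
  have step: "g (F + t *\<^sub>R outer a a) = g F + t * L a" for F t a
    unfolding L_def by (rule slope_constant[OF g]) (simp add: g_def sym_part_sym_part)
  have step0: "g (t *\<^sub>R outer a a) = g 0 + t * L a" for t a
    using step[of 0] by simp
  \<comment> \<open>In the end \<open>L a = a \<bullet> (B *v a)\<close>, so \<open>B\<close> is read off from \<open>L\<close> by polarization.\<close>
  define B :: mat3 where "B = (\<chi> i j. if i = j then L (axis i 1)
      else (L (axis i 1 + axis j 1) - L (axis i 1) - L (axis j 1)) / 2)"
  have "B \<in> sym_mats"
    by (simp add: sym_mats_def transpose_def vec_eq_iff B_def add.commute)
  moreover have "f \<epsilon> = B \<bullet> \<epsilon> + g 0" if \<epsilon>: "\<epsilon> \<in> sym_mats" for \<epsilon>
  proof -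
    have sy: "\<epsilon>$2$1 = \<epsilon>$1$2" "\<epsilon>$3$1 = \<epsilon>$1$3" "\<epsilon>$3$2 = \<epsilon>$2$3"
      using \<epsilon> by (simp_all add: sym_mats_def transpose_def vec_eq_iff)
    have "f \<epsilon> = g \<epsilon>" using \<epsilon> by (simp add: g_def sym_part_of_sym)
    also have "\<dots> = g 0 + (\<epsilon>$1$1 - \<epsilon>$1$2 - \<epsilon>$1$3) * L (axis 1 1)
           + (\<epsilon>$2$2 - \<epsilon>$1$2 - \<epsilon>$2$3) * L (axis 2 1)
           + (\<epsilon>$3$3 - \<epsilon>$1$3 - \<epsilon>$2$3) * L (axis 3 1)
           + \<epsilon>$1$2 * L (axis 1 1 + axis 2 1)
           + \<epsilon>$1$3 * L (axis 1 1 + axis 3 1)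
           + \<epsilon>$2$3 * L (axis 2 1 + axis 3 1)"
      by (subst symmetric_dyad_decomposition[OF \<epsilon>]) (simp only: step step0)
    also have "\<dots> = B \<bullet> \<epsilon> + g 0"
      by (simp add: inner_mat3 sum_3 B_def sy add.commute[of "axis 2 1" "axis 1 1"]
          add.commute[of "axis 3 1" "axis 1 1"] add.commute[of "axis 3 1" "axis 2 1"])
         (simp add: field_simps)
    finally show ?thesis .
  qed
  ultimately show ?thesis by blast
qed

section \<open>Affine functions are symmetric polyaffine\<close>

lemma affine_imp_symmetric_polyconvex:
  assumes "\<And>\<epsilon>. \<epsilon> \<in> sym_mats \<Longrightarrow> f \<epsilon> = B \<bullet> \<epsilon> + b"
  shows "symmetric_polyconvex f"
proof -
  define G :: "mat3 \<times> mat3 \<times> real \<Rightarrow> real" where "G p = B \<bullet> sym_part (fst p) + b" for p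
  have "convex_on UNIV G"
  proof (rule convex_onI)
    fix t x y
    show "G ((1 - t) *\<^sub>R x + t *\<^sub>R y) \<le> (1 - t) * G x + t * G y"
      by (simp only: G_def fst_add fst_scaleR sym_part_add sym_part_scaleR inner_add_right
          inner_scaleR_right) (simp add: algebra_simps)
  qed simp
  moreover have "f (sym_part F) = G (F, cof F, det F)" for F
    by (simp add: G_def assms sym_part_in_sym_mats)
  ultimately show ?thesis
    unfolding symmetric_polyconvex_def polyconvex_def by blast
qed

theorem proposition5p10:
  fixes f :: "real^3^3 \<Rightarrow> real"
  shows "symmetric_polyaffine f \<longleftrightarrow>
    (\<exists>B\<in>sym_mats. \<exists>b::real. \<forall>\<epsilon>\<in>sym_mats. f \<epsilon> = B \<bullet> \<epsilon> + b)"
proof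
  assume "symmetric_polyaffine f"
  then show "\<exists>B\<in>sym_mats. \<exists>b. \<forall>\<epsilon>\<in>sym_mats. f \<epsilon> = B \<bullet> \<epsilon> + b"
    by (rule symmetric_polyaffine_imp_affine)
next
  assume "\<exists>B\<in>sym_mats. \<exists>b. \<forall>\<epsilon>\<in>sym_mats. f \<epsilon> = B \<bullet> \<epsilon> + b"
  then obtain B b where f: "\<And>\<epsilon>. \<epsilon> \<in> sym_mats \<Longrightarrow> f \<epsilon> = B \<bullet> \<epsilon> + b" by blast
  have "symmetric_polyconvex f"
    using f by (rule affine_imp_symmetric_polyconvex)
  moreover have "symmetric_polyconvex (\<lambda>\<epsilon>. - f \<epsilon>)"
    by (rule affine_imp_symmetric_polyconvex[of _ "- B" "- b"]) (simp add: f)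
  ultimately show "symmetric_polyaffine f"
    by (simp add: symmetric_polyaffine_def)
qed

end
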